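(* Let $d\in\mathbb{N}$, $d\ge 1$, and let $\lambda_1,\dots,\lambda_d>0$ be real numbers. Let $e_0=1$, for $r=1,\dots,d$ let $e_r$ be the $r$-th elementary symmetric polynomial evaluated at $\frac{1}{\lambda_1},\dots,\frac{1}{\lambda_d}$, and for $r=1,\dots,d-1$ let $\mu_r:=(d-r)e_r-(r-1)e_{r-1}$. Then the polynomial equation in the real variable $\beta$ $$d\,\beta^{d+1}+(d-1)e_1\beta^{d}+\left(\sum_{r=1}^{d-1}\mu_r\,\beta^{d-r+1}\right)-(d-1)e_{d-1}\beta-d\,e_d=0,$$ where for $d=1$ the empty sum is $0$ (equivalently, the equation $\sum_{i=1}^{d}\left(\beta^2-\frac{1}{\lambda_i}\right)\prod_{j\neq i}\left(\beta+\frac{1}{\lambda_j}\right)=0$, or equivalently $\sum_{i=1}^{d}(\beta^2\lambda_i-1)\prod_{j\neq i}(\beta\lambda_j+1)=0$), has a unique positive root $\beta_+$.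
   Context: The $r$-th elementary symmetric polynomial is $e_r=\sum_{1\le i_1<i_2<\cdots<i_r\le d}\frac{1}{\lambda_{i_1}\cdots\lambda_{i_r}}$, with $e_0=1$; products over $j\ne i$ run over $j\in\{1,\dots,d\}\setminus\{i\}$, and empty products equal $1$. In the paper, $\lambda_1,\dots,\lambda_d$ are the (positive) eigenvalues of $Q_1^{-1}Q_2$ for real symmetric positive definite $d\times d$ matrices $Q_1,Q_2$. For $\beta>0$ the equation is equivalent to the first order optimality condition $\sum_{i=1}^d\frac{1-\beta^2\lambda_i}{1+\beta\lambda_i}=0$ for minimizing $\log\det\left(\left(1+\frac1\beta\right)Q_1+(1+\beta)Q_2\right)$ over $\beta>0$.
   Formalization: The displayed equation counts (d-1)e_1β^d twice (μ_1=(d-1)e_1), so for d≥2 it is not equivalent to the product forms; the equivalence is proved with the sum starting at r=2. A unique positive root is proved for the display as printed, the corrected one and both product forms. *)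

theory Defs
  imports Complex_Main
begin

definition elem_sym :: "nat \<Rightarrow> (nat \<Rightarrow> real) \<Rightarrow> nat \<Rightarrow> real" where
  "elem_sym d x r = (\<Sum>S\<in>{S. S \<subseteq> {1..d} \<and> card S = r}. \<Prod>i\<in>S. x i)"

definition recip_esym :: "nat \<Rightarrow> (nat \<Rightarrow> real) \<Rightarrow> nat \<Rightarrow> real" where
  "recip_esym d lam r = elem_sym d (\<lambda>i. 1 / lam i) r"

(* Only meant for r >= 1.  Since mu d lam 1 = (d - 1) e_1, a sum of the terms
   mu d lam r * \<beta>^(d - r + 1) starting at r = 1 already contains (d - 1) e_1 \<beta>^d.
   A polynomial that lists this term separately agrees with the expansion of
   \<Sum>i (\<beta>^2 - 1 / lam i) * \<Prod>j\<noteq>i (\<beta> + 1 / lam j) only if its sum starts at r = 2. *)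
definition mu :: "nat \<Rightarrow> (nat \<Rightarrow> real) \<Rightarrow> nat \<Rightarrow> real" where
  "mu d lam r = (real d - real r) * recip_esym d lam r
     - (real r - 1) * recip_esym d lam (r - 1)"

end

theory Submission
  imports Defs
begin

text \<open>
  Put \<open>x i = 1 / lam i\<close> and let \<open>P \<beta> = (\<Prod>i. \<beta> + x i)\<close>, in which \<open>\<beta> ^ (d - k)\<close> has the coefficient
  \<open>e\<^sub>k\<close>. For \<open>\<beta> \<ge> 0\<close>, dividing the sum form \<open>F \<beta> = (\<Sum>i. (\<beta>\<^sup>2 - x i) * (\<Prod>j\<noteq>i. \<beta> + x j))\<close> by the
  positive number \<open>P \<beta>\<close> gives \<open>\<Sum>i. (\<beta>\<^sup>2 - x i) / (\<beta> + x i)\<close>, and every summand is strictly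
  increasing on \<open>\<beta> \<ge> 0\<close>. Since \<open>F\<close> is negative at \<open>0\<close> and positive for large \<open>\<beta>\<close>, it has exactly
  one positive root.

  To pass to the coefficient form, note that \<open>\<Sum>i. \<Prod>j\<noteq>i. \<beta> + x j\<close> is the derivative of \<open>P\<close>, and
  \<open>\<beta>\<^sup>2 - x i = (\<beta>\<^sup>2 + \<beta>) - (\<beta> + x i)\<close>, so \<open>F = (\<beta>\<^sup>2 + \<beta>) * P' - d * P\<close>. Comparing coefficients
  yields \<open>F \<beta> = d \<beta> ^ (d + 1) + (\<Sum>r = 1..d. mu r * \<beta> ^ (d - r + 1)) - d e\<^sub>d\<close>. Here \<open>mu 1\<close> equals
  \<open>(d - 1) e\<^sub>1\<close> and \<open>mu d\<close> equals \<open>- (d - 1) e\<^bsub>d-1\<^esub>\<close>. Hence the polynomial that lists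
  \<open>(d - 1) e\<^sub>1 \<beta> ^ d\<close> separately is \<open>F\<close> when its sum starts at \<open>r = 2\<close>, and is
  \<open>F + (d - 1) e\<^sub>1 \<beta> ^ d\<close> when its sum starts at \<open>r = 1\<close>.

  The second polynomial is covered by the same monotonicity argument, because
  \<open>\<beta> ^ d / P \<beta> = (\<Prod>i. \<beta> / (\<beta> + x i))\<close> is nondecreasing: \<open>F + c \<beta> ^ d\<close> has exactly one positive
  root for every \<open>c \<ge> 0\<close>. This is the lemma \<open>ex1_pos_root_sum_plus_power\<close>.
\<close>

section \<open>Expansion in elementary symmetric polynomials\<close>

lemma prod_add_eq_sum_elem_sym:
  "(\<Prod>i\<in>{1..d}. b + x i) = (\<Sum>k\<le>d. elem_sym d x k * b ^ (d - k))"
proof -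
  have "(\<Prod>i\<in>{1..d}. b + x i) = (\<Prod>i\<in>{1..d}. x i + b)"
    by (simp add: add.commute)
  also have "\<dots> = (\<Sum>S\<in>Pow {1..d}. (\<Prod>i\<in>S. x i) * (\<Prod>i\<in>{1..d} - S. b))"
    by (rule prod_add) simp
  also have "\<dots> = (\<Sum>S\<in>Pow {1..d}. (\<Prod>i\<in>S. x i) * b ^ (d - card S))"
    by (rule sum.cong) (auto simp: card_Diff_subset finite_subset)
  also have "\<dots> = (\<Sum>k\<le>d. \<Sum>S\<in>{S \<in> Pow {1..d}. card S = k}. (\<Prod>i\<in>S. x i) * b ^ (d - card S))"
    by (rule sum.group [symmetric]) (auto dest: card_mono [rotated])
  also have "\<dots> = (\<Sum>k\<le>d. elem_sym d x k * b ^ (d - k))"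
    by (auto simp: elem_sym_def sum_distrib_right intro!: sum.cong)
  finally show ?thesis .
qed

text \<open>Both sides are the derivative of \<open>\<Prod>i. b + x i\<close>, by the product rule and term by term.\<close>

lemma sum_prod_add_delete_eq_sum_elem_sym:
  "(\<Sum>i\<in>{1..d}. \<Prod>j\<in>{1..d} - {i}. b + x j)
     = (\<Sum>k\<le>d. (real d - real k) * elem_sym d x k * b ^ (d - k - 1))"
proof -
  have "((\<lambda>b. \<Prod>i\<in>{1..d}. b + x i) has_field_derivative
          (\<Sum>i\<in>{1..d}. 1 * (\<Prod>j\<in>{1..d} - {i}. b + x j))) (at b)"
    by (rule has_field_derivative_prod) (auto intro!: derivative_eq_intros)
  moreover have "((\<lambda>b. \<Sum>k\<le>d. elem_sym d x k * b ^ (d - k)) has_field_derivative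
          (\<Sum>k\<le>d. (real d - real k) * elem_sym d x k * b ^ (d - k - 1))) (at b)"
    by (auto intro!: derivative_eq_intros sum.cong simp: of_nat_diff)
  ultimately show ?thesis
    unfolding prod_add_eq_sum_elem_sym by (auto dest: DERIV_unique)
qed

lemma elem_sym_0 [simp]: "elem_sym d x 0 = 1"
proof -
  have "{S. S \<subseteq> {1..d} \<and> card S = 0} = {{}}"
    by (auto dest: finite_subset)
  then show ?thesis
    by (simp only: elem_sym_def) simp
qed

lemma elem_sym_nonneg:
  assumes "\<And>i. i \<in> {1..d} \<Longrightarrow> 0 \<le> x i"
  shows "0 \<le> elem_sym d x r"
  unfolding elem_sym_def by (intro sum_nonneg prod_nonneg) (use assms in blast)

text \<open>
  In \<open>(b\<^sup>2 + b) * P' - d * P\<close> the part \<open>b * P' - d * P\<close> has coefficients \<open>- k e\<^sub>k\<close>. Shifting the index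
  there by one aligns its powers of \<open>b\<close> with those of \<open>b\<^sup>2 * P'\<close>.
\<close>

lemma sum_prod_delete_expansion:
  "(\<Sum>i\<in>{1..d}. (b\<^sup>2 - x i) * (\<Prod>j\<in>{1..d} - {i}. b + x j))
     = real d * b ^ (d + 1)
       + (\<Sum>r = 1..d. ((real d - real r) * elem_sym d x r
                       - (real r - 1) * elem_sym d x (r - 1)) * b ^ (d - r + 1))
       - real d * elem_sym d x d"
proof -
  let ?e = "elem_sym d x"
  have summand: "(b\<^sup>2 - x i) * (\<Prod>j\<in>{1..d} - {i}. b + x j)
      = (b\<^sup>2 + b) * (\<Prod>j\<in>{1..d} - {i}. b + x j) - (\<Prod>j\<in>{1..d}. b + x j)"
    if "i \<in> {1..d}" for i
    by (simp only: prod.remove [OF finite_atLeastAtMost that]) (simp add: algebra_simps)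
  have "(\<Sum>i\<in>{1..d}. (b\<^sup>2 - x i) * (\<Prod>j\<in>{1..d} - {i}. b + x j))
      = (\<Sum>i\<in>{1..d}. (b\<^sup>2 + b) * (\<Prod>j\<in>{1..d} - {i}. b + x j) - (\<Prod>j\<in>{1..d}. b + x j))"
    by (rule sum.cong [OF refl]) (rule summand)
  also have "\<dots> = (b\<^sup>2 + b) * (\<Sum>i\<in>{1..d}. \<Prod>j\<in>{1..d} - {i}. b + x j)
      - real d * (\<Prod>j\<in>{1..d}. b + x j)"
    by (simp add: sum_subtractf sum_distrib_left)
  also have "\<dots> = (\<Sum>k\<le>d. (b\<^sup>2 + b) * ((real d - real k) * ?e k * b ^ (d - k - 1))
                         - real d * (?e k * b ^ (d - k)))"
    by (simp only: sum_prod_add_delete_eq_sum_elem_sym prod_add_eq_sum_elem_sym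
          sum_subtractf sum_distrib_left)
  also have "\<dots> = (\<Sum>k\<le>d. (real d - real k) * ?e k * b ^ (d - k + 1) - real k * ?e k * b ^ (d - k))"
  proof (rule sum.cong)
    fix k assume "k \<in> {..d}"
    show "(b\<^sup>2 + b) * ((real d - real k) * ?e k * b ^ (d - k - 1)) - real d * (?e k * b ^ (d - k))
      = (real d - real k) * ?e k * b ^ (d - k + 1) - real k * ?e k * b ^ (d - k)"
    proof (cases "k = d")
      case False
      with \<open>k \<in> {..d}\<close> obtain m where "d - k = Suc m"
        by (metis Suc_diff_Suc atMost_iff order_le_imp_less_or_eq)
      then show ?thesis
        by (simp add: algebra_simps power2_eq_square)
    qed simp
  qed simp
  also have "\<dots> = (\<Sum>k\<le>d. (real d - real k) * ?e k * b ^ (d - k + 1))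
                 - (\<Sum>k\<le>d. real k * ?e k * b ^ (d - k))"
    by (rule sum_subtractf)
  also have "(\<Sum>k\<le>d. (real d - real k) * ?e k * b ^ (d - k + 1))
      = real d * b ^ (d + 1) + (\<Sum>r = 1..d. (real d - real r) * ?e r * b ^ (d - r + 1))"
    by (simp add: sum.atMost_shift sum.atLeast1_atMost_eq)
  also have "(\<Sum>k\<le>d. real k * ?e k * b ^ (d - k)) = (\<Sum>k<d. real k * ?e k * b ^ (d - k)) + real d * ?e d"
    by (simp add: lessThan_Suc_atMost [symmetric])
  also have "(\<Sum>k<d. real k * ?e k * b ^ (d - k))
      = (\<Sum>r = 1..d. (real r - 1) * ?e (r - 1) * b ^ (d - r + 1))"
    unfolding One_nat_def sum.atLeast1_atMost_eq
    by (rule sum.cong) (simp_all add: Suc_diff_Suc flip: power_Suc)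
  finally show ?thesis
    by (simp add: sum_subtractf left_diff_distrib)
qed

text \<open>
  The outer terms \<open>r = 1\<close> and \<open>r = d\<close> of the full sum are the separately listed monomials of degrees
  \<open>d\<close> and \<open>1\<close>. For \<open>d = 1\<close> the two coincide, and both vanish because of the factor \<open>d - 1\<close>.
\<close>

lemma coefficient_form_eq_sum_form:
  assumes "d \<ge> 1"
  shows "real d * b ^ (d + 1) + (real d - 1) * recip_esym d lam 1 * b ^ d
        + (\<Sum>r = 2..d - 1. mu d lam r * b ^ (d - r + 1))
        - (real d - 1) * recip_esym d lam (d - 1) * b - real d * recip_esym d lam d
      = (\<Sum>i = 1..d. (b\<^sup>2 - 1 / lam i) * (\<Prod>j\<in>{1..d} - {i}. b + 1 / lam j))"
proof -
  have F: "(\<Sum>i = 1..d. (b\<^sup>2 - 1 / lam i) * (\<Prod>j\<in>{1..d} - {i}. b + 1 / lam j))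
      = real d * b ^ (d + 1) + (\<Sum>r = 1..d. mu d lam r * b ^ (d - r + 1)) - real d * recip_esym d lam d"
    unfolding mu_def recip_esym_def by (rule sum_prod_delete_expansion)
  show ?thesis
  proof (cases "d = 1")
    case True
    then show ?thesis
      unfolding F by (simp add: mu_def)
  next
    case False
    with assms have d: "d = Suc (d - 1)" "1 \<le> d - 1"
      by auto
    have "(\<Sum>r = 1..d. mu d lam r * b ^ (d - r + 1))
        = (\<Sum>r = 1..d - 1. mu d lam r * b ^ (d - r + 1)) + mu d lam d * b"
      by (subst d(1), subst sum.nat_ivl_Suc') (use d in auto)
    also have "(\<Sum>r = 1..d - 1. mu d lam r * b ^ (d - r + 1))
        = mu d lam 1 * b ^ d + (\<Sum>r = 2..d - 1. mu d lam r * b ^ (d - r + 1))"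
      using d(2) by (subst sum.atLeast_Suc_atMost) (auto simp: numeral_2_eq_2)
    finally show ?thesis
      unfolding F by (simp add: mu_def)
  qed
qed

section \<open>Uniqueness of the positive root\<close>

text \<open>Cross-multiplied, the difference of the two sides factors as \<open>(t - s) * (s t + x (s + t) + x)\<close>.\<close>

lemma square_minus_div_add_strict_mono:
  fixes s t x :: real
  assumes "0 \<le> s" "s < t" "0 < x"
  shows "(s\<^sup>2 - x) / (s + x) < (t\<^sup>2 - x) / (t + x)"
proof -
  have "0 < (t - s) * (s * t + x * (s + t) + x)"
    using assms by (intro mult_pos_pos add_nonneg_pos add_nonneg_nonneg mult_nonneg_nonneg) auto
  then have "(s\<^sup>2 - x) * (t + x) < (t\<^sup>2 - x) * (s + x)"
    by (simp add: algebra_simps power2_eq_square)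
  then show ?thesis
    using assms by (simp add: divide_less_eq less_divide_eq field_simps)
qed

lemma ex1_pos_root_sum_plus_power:
  fixes x :: "'a \<Rightarrow> real" and c :: real
  assumes A: "finite A" "A \<noteq> {}" and x: "\<And>i. i \<in> A \<Longrightarrow> 0 < x i" and c: "0 \<le> c"
  shows "\<exists>!b. 0 < b \<and> (\<Sum>i\<in>A. (b\<^sup>2 - x i) * (\<Prod>j\<in>A - {i}. b + x j)) + c * b ^ card A = 0"
    (is "\<exists>!b. 0 < b \<and> ?f b = 0")
proof -
  define P where "P b = (\<Prod>i\<in>A. b + x i)" for b
  define g where "g b = (\<Sum>i\<in>A. (b\<^sup>2 - x i) / (b + x i)) + c * (\<Prod>i\<in>A. b / (b + x i))" for b
  have P_pos: "0 < P b" if "0 \<le> b" for b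
    unfolding P_def using that x by (intro prod_pos ballI) (simp add: add_nonneg_pos)
  have f_eq: "?f b = P b * g b" if "0 \<le> b" for b
  proof -
    have "(b\<^sup>2 - x i) * (\<Prod>j\<in>A - {i}. b + x j) = P b * ((b\<^sup>2 - x i) / (b + x i))" if "i \<in> A" for i
      using x [OF that] \<open>0 \<le> b\<close> by (simp add: P_def prod.remove [OF A(1) that])
    moreover have "c * b ^ card A = P b * (c * (\<Prod>i\<in>A. b / (b + x i)))"
      using P_pos [OF that] by (simp add: prod_dividef P_def)
    ultimately show ?thesis
      by (simp add: g_def distrib_left sum_distrib_left cong: sum.cong)
  qed
  have root_iff: "?f b = 0 \<longleftrightarrow> g b = 0" if "0 \<le> b" for b
    using f_eq [OF that] P_pos [OF that] by simp
  have g_less: "g s < g t" if "0 \<le> s" "s < t" for s t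
  proof -
    have "(\<Sum>i\<in>A. (s\<^sup>2 - x i) / (s + x i)) < (\<Sum>i\<in>A. (t\<^sup>2 - x i) / (t + x i))"
      using A that x by (intro sum_strict_mono square_minus_div_add_strict_mono) auto
    moreover have "s / (s + x i) \<le> t / (t + x i)" if "i \<in> A" for i
      using \<open>0 \<le> s\<close> \<open>s < t\<close> x [OF that] by (simp add: field_simps)
    then have "(\<Prod>i\<in>A. s / (s + x i)) \<le> (\<Prod>i\<in>A. t / (t + x i))"
      using that x by (intro prod_mono) (auto simp: less_imp_le)
    ultimately show ?thesis
      unfolding g_def using c by (intro add_less_le_mono mult_left_mono)
  qed
  \<comment> \<open>From \<open>B \<ge> 1\<close> and \<open>B \<ge> x i\<close> it follows that \<open>B\<^sup>2 \<ge> x i\<close>, so no summand is negative at \<open>B\<close>.\<close>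
  define B where "B = 1 + sum x A"
  have "0 \<le> sum x A"
    using x by (intro sum_nonneg) (auto simp: less_imp_le)
  then have "1 \<le> B"
    by (simp add: B_def)
  have f_0: "?f 0 < 0"
  proof -
    have "(\<Sum>i\<in>A. (0\<^sup>2 - x i) * (\<Prod>j\<in>A - {i}. 0 + x j)) < (\<Sum>i\<in>A. 0)"
      using A x by (intro sum_strict_mono mult_neg_pos prod_pos) auto
    then show ?thesis
      using A by (simp add: card_gt_0_iff zero_power)
  qed
  have f_B: "0 \<le> ?f B"
  proof -
    have "x i \<le> B\<^sup>2" if "i \<in> A" for i
    proof -
      have "x i \<le> sum x A"
        using A(1) x that by (intro member_le_sum) (auto simp: less_imp_le)
      also have "\<dots> \<le> B" by (simp add: B_def)
      also have "\<dots> \<le> B\<^sup>2" using \<open>1 \<le> B\<close> by (simp add: power2_eq_square)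
      finally show ?thesis .
    qed
    then show ?thesis
      using x c \<open>1 \<le> B\<close>
      by (intro add_nonneg_nonneg sum_nonneg mult_nonneg_nonneg prod_nonneg) (auto simp: less_imp_le)
  qed
  have "continuous_on {0..B} ?f"
    by (intro continuous_intros)
  with f_0 f_B \<open>1 \<le> B\<close> obtain b where b: "0 \<le> b" "?f b = 0"
    using IVT' [of ?f 0 0 B] by auto
  with f_0 have "0 < b"
    by (metis order_le_less)
  show ?thesis
  proof (rule ex1I [of _ b])
    show "0 < b \<and> ?f b = 0"
      using b \<open>0 < b\<close> by simp
    fix b' assume b': "0 < b' \<and> ?f b' = 0"
    then have "g b' = g b"
      using root_iff [of b] root_iff [of b'] b by simp
    then show "b' = b"
      using g_less [of b b'] g_less [of b' b] b b' by (metis less_irrefl less_imp_le linorder_neqE)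
  qed
qed

section \<open>The equivalent forms of the equation\<close>

text \<open>Each summand changes by the factor \<open>\<Prod>i. l i\<close>, with \<open>l j\<close> absorbed by the factor of index \<open>j\<close>.\<close>

lemma sum_prod_delete_rescale:
  fixes l :: "'a \<Rightarrow> real"
  assumes "finite A" and l: "\<And>i. i \<in> A \<Longrightarrow> l i \<noteq> 0"
  shows "(\<Sum>i\<in>A. (b\<^sup>2 * l i - 1) * (\<Prod>j\<in>A - {i}. b * l j + 1))
     = (\<Prod>i\<in>A. l i) * (\<Sum>i\<in>A. (b\<^sup>2 - 1 / l i) * (\<Prod>j\<in>A - {i}. b + 1 / l j))"
  unfolding sum_distrib_left
proof (rule sum.cong)
  fix i assume i: "i \<in> A"
  have "(\<Prod>j\<in>A - {i}. b * l j + 1) = (\<Prod>j\<in>A - {i}. l j * (b + 1 / l j))"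
    using l by (intro prod.cong) (auto simp: field_simps)
  also have "\<dots> = (\<Prod>j\<in>A - {i}. l j) * (\<Prod>j\<in>A - {i}. b + 1 / l j)"
    by (rule prod.distrib)
  finally show "(b\<^sup>2 * l i - 1) * (\<Prod>j\<in>A - {i}. b * l j + 1)
      = (\<Prod>i\<in>A. l i) * ((b\<^sup>2 - 1 / l i) * (\<Prod>j\<in>A - {i}. b + 1 / l j))"
    using l [OF i] by (simp add: prod.remove [OF assms(1) i] field_simps)
qed simp

theorem theorem2:
  fixes d :: nat and lam :: "nat \<Rightarrow> real"
  assumes "d \<ge> 1"
    and "\<And>i. i \<in> {1..d} \<Longrightarrow> lam i > 0"
  shows
    "(\<exists>!\<beta>::real. \<beta> > 0 \<and>
        real d * \<beta> ^ (d + 1) + (real d - 1) * recip_esym d lam 1 * \<beta> ^ d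
        + (\<Sum>r = 1..d - 1. mu d lam r * \<beta> ^ (d - r + 1))
        - (real d - 1) * recip_esym d lam (d - 1) * \<beta> - real d * recip_esym d lam d = 0)
   \<and> (\<exists>!\<beta>::real. \<beta> > 0 \<and>
        real d * \<beta> ^ (d + 1) + (real d - 1) * recip_esym d lam 1 * \<beta> ^ d
        + (\<Sum>r = 2..d - 1. mu d lam r * \<beta> ^ (d - r + 1))
        - (real d - 1) * recip_esym d lam (d - 1) * \<beta> - real d * recip_esym d lam d = 0)
   \<and> (\<exists>!\<beta>::real. \<beta> > 0 \<and>
        (\<Sum>i = 1..d. (\<beta>\<^sup>2 - 1 / lam i) * (\<Prod>j\<in>{1..d} - {i}. \<beta> + 1 / lam j)) = 0)
   \<and> (\<exists>!\<beta>::real. \<beta> > 0 \<and>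
        (\<Sum>i = 1..d. (\<beta>\<^sup>2 * lam i - 1) * (\<Prod>j\<in>{1..d} - {i}. \<beta> * lam j + 1)) = 0)
   \<and> (\<forall>\<beta>::real.
        (real d * \<beta> ^ (d + 1) + (real d - 1) * recip_esym d lam 1 * \<beta> ^ d
          + (\<Sum>r = 2..d - 1. mu d lam r * \<beta> ^ (d - r + 1))
          - (real d - 1) * recip_esym d lam (d - 1) * \<beta> - real d * recip_esym d lam d = 0)
        \<longleftrightarrow> (\<Sum>i = 1..d. (\<beta>\<^sup>2 - 1 / lam i) * (\<Prod>j\<in>{1..d} - {i}. \<beta> + 1 / lam j)) = 0)
   \<and> (\<forall>\<beta>::real.
        (\<Sum>i = 1..d. (\<beta>\<^sup>2 - 1 / lam i) * (\<Prod>j\<in>{1..d} - {i}. \<beta> + 1 / lam j)) = 0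
        \<longleftrightarrow> (\<Sum>i = 1..d. (\<beta>\<^sup>2 * lam i - 1) * (\<Prod>j\<in>{1..d} - {i}. \<beta> * lam j + 1)) = 0)"
proof -
  let ?F = "\<lambda>b. \<Sum>i = 1..d. (b\<^sup>2 - 1 / lam i) * (\<Prod>j\<in>{1..d} - {i}. b + 1 / lam j)"
  let ?H = "\<lambda>b. \<Sum>i = 1..d. (b\<^sup>2 * lam i - 1) * (\<Prod>j\<in>{1..d} - {i}. b * lam j + 1)"
  let ?poly = "\<lambda>m b. real d * b ^ (d + 1) + (real d - 1) * recip_esym d lam 1 * b ^ d
        + (\<Sum>r = m..d - 1. mu d lam r * b ^ (d - r + 1))
        - (real d - 1) * recip_esym d lam (d - 1) * b - real d * recip_esym d lam d"
  \<comment> \<open>The excess coefficient when the sum starts at \<open>r = 1\<close>; for \<open>d = 1\<close> that sum is empty and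
    \<open>c = 0\<close>.\<close>
  define c where "c = (real d - 1) * recip_esym d lam 1"
  have "0 \<le> c"
    unfolding c_def recip_esym_def using assms
    by (intro mult_nonneg_nonneg elem_sym_nonneg) (auto simp: less_imp_le)
  have poly2: "?poly 2 b = ?F b" for b
    using assms(1) by (rule coefficient_form_eq_sum_form)
  have poly1: "?poly 1 b = ?F b + c * b ^ d" for b
  proof (cases "d = 1")
    case True
    then show ?thesis
      using poly2 [of b] by (simp add: c_def)
  next
    case False
    with assms(1) have "1 \<le> d - 1"
      by simp
    then have "(\<Sum>r = 1..d - 1. mu d lam r * b ^ (d - r + 1))
        = c * b ^ d + (\<Sum>r = 2..d - 1. mu d lam r * b ^ (d - r + 1))"
      by (subst sum.atLeast_Suc_atMost) (auto simp: numeral_2_eq_2 mu_def c_def)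
    then show ?thesis
      using poly2 [of b] by simp
  qed
  have root: "\<exists>!b. 0 < b \<and> ?F b + a * b ^ d = 0" if "0 \<le> a" for a
    using ex1_pos_root_sum_plus_power [of "{1..d}" "\<lambda>i. 1 / lam i" a] assms that by simp
  have F_root: "\<exists>!b. 0 < b \<and> ?F b = 0"
    using root [of 0] by simp
  have "0 < (\<Prod>i = 1..d. lam i)"
    using assms(2) by (intro prod_pos) blast
  moreover have "?H b = (\<Prod>i = 1..d. lam i) * ?F b" for b
    using assms(2) by (intro sum_prod_delete_rescale) (auto simp: less_le)
  ultimately have H_iff: "?F b = 0 \<longleftrightarrow> ?H b = 0" for b
    by (metis (no_types, lifting) less_irrefl mult_eq_0_iff)
  show ?thesis
    unfolding poly1 poly2 H_iff [symmetric]
    using root [OF \<open>0 \<le> c\<close>] F_root by blast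
qed

end
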